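(* Assume $\eta>0$ is less than a universal constant. Consider any algorithm that takes $m$ samples $x_1,\dots,x_m\sim\mathcal{D}_\eta$ ($m$ arbitrary, not necessarily polynomial in $n$), where $\mathcal{D}$ is an unknown distribution with mean $\mu\in\mathbb{R}^n$ and covariance $\Sigma$, and computes an estimate $\widehat\mu$. Then: (1) If $\mathcal{D}$ is only known to be a Gaussian $N(\mu,\Sigma)$, there are such a $\mathcal{D}$ and a choice of the adversarial noise for which, with constant probability, $\|\mu-\widehat\mu\|_2=\Omega\left(\eta\sqrt{\|\Sigma\|_2}\right)$. (2) If $\mathcal{D}$ is only known to have bounded fourth moments (with a universal constant $C_4$), there are such a $\mathcal{D}$ and a choice of the adversarial noise for which, with constant probability, $\|\mu-\widehat\mu\|_2=\Omega\left(\eta^{3/4}\sqrt{\|\Sigma\|_2}\right)$.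
   Context: Noise model: for a distribution $\mathcal{D}$ on $\mathbb{R}^n$ and $\eta\in[0,1)$, the notation $x_1,\dots,x_m\sim\mathcal{D}_\eta$ means that each $x_i$ is, with probability $1-\eta$, sampled independently from $\mathcal{D}$, and with probability $\eta$ is chosen by an adversary (it is completely arbitrary). Bounded fourth moments: $\mathcal{D}$ with mean $\mu$ has bounded fourth moments with constant $C_4$ if for every unit vector $v$, $\mathbb{E}_{x\sim\mathcal{D}}\left((x-\mu)^Tv\right)^4\le C_4\left(\mathbb{E}_{x\sim\mathcal{D}}\left((x-\mu)^Tv\right)^2\right)^2$. For a vector $\|\cdot\|_2$ is the Euclidean norm; for a matrix it is the operator norm. Constants in $\Omega(\cdot)$ and the "constant probability" are universal. *)

theory Defs
  imports "HOL-Probability.Probability"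
begin

text \<open>
  The constants of the theorem are universal, in particular independent of the dimension, so the
  dimension has to be quantified inside the formula and cannot be a type. A vector of
  \<open>\<real>\<^sup>n\<close> is a function on the indices \<open>{..<n}\<close>, its Euclidean norm is
  \<^term>\<open>L2_set x {..<n}\<close>, and a matrix is a function of two indices below \<open>n\<close>.
\<close>

definition Rn :: "nat \<Rightarrow> (nat \<Rightarrow> real) measure" where
  "Rn n = PiM {..<n} (\<lambda>_. borel)"

definition dotp :: "nat \<Rightarrow> (nat \<Rightarrow> real) \<Rightarrow> (nat \<Rightarrow> real) \<Rightarrow> real" where
  "dotp n u v = (\<Sum>i<n. u i * v i)"

definition mat_apply :: "nat \<Rightarrow> (nat \<Rightarrow> nat \<Rightarrow> real) \<Rightarrow> (nat \<Rightarrow> real) \<Rightarrow> nat \<Rightarrow> real" where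
  "mat_apply n S v = (\<lambda>i. \<Sum>j<n. S i j * v j)"

definition op_norm :: "nat \<Rightarrow> (nat \<Rightarrow> nat \<Rightarrow> real) \<Rightarrow> real" where
  "op_norm n S = (SUP v\<in>{v. L2_set v {..<n} = 1}. L2_set (mat_apply n S v) {..<n})"


definition distribution_on :: "nat \<Rightarrow> (nat \<Rightarrow> real) measure \<Rightarrow> bool" where
  "distribution_on n D \<longleftrightarrow> prob_space D \<and> sets D = sets (Rn n)"

text \<open>
  The Bochner integral of a non-integrable function is \<open>0\<close>, so finiteness of the moments
  is demanded explicitly, here and for the fourth moments.
\<close>

definition has_mean_cov ::
  "nat \<Rightarrow> (nat \<Rightarrow> real) measure \<Rightarrow> (nat \<Rightarrow> real) \<Rightarrow> (nat \<Rightarrow> nat \<Rightarrow> real) \<Rightarrow> bool" where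
  "has_mean_cov n D \<mu> S \<longleftrightarrow>
     (\<forall>i<n. integrable D (\<lambda>x. x i) \<and> integrable D (\<lambda>x. (x i)\<^sup>2)) \<and>
     (\<forall>i<n. \<mu> i = (\<integral>x. x i \<partial>D)) \<and>
     (\<forall>i<n. \<forall>j<n. S i j = (\<integral>x. (x i - \<mu> i) * (x j - \<mu> j) \<partial>D))"

definition bounded_fourth_moments ::
  "nat \<Rightarrow> real \<Rightarrow> (nat \<Rightarrow> real) measure \<Rightarrow> (nat \<Rightarrow> real) \<Rightarrow> bool" where
  "bounded_fourth_moments n C4 D \<mu> \<longleftrightarrow>
     (\<forall>v. L2_set v {..<n} = 1 \<longrightarrow>
        integrable D (\<lambda>x. (dotp n (\<lambda>i. x i - \<mu> i) v) ^ 4) \<and>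
        (\<integral>x. (dotp n (\<lambda>i. x i - \<mu> i) v) ^ 4 \<partial>D)
          \<le> C4 * (\<integral>x. (dotp n (\<lambda>i. x i - \<mu> i) v)\<^sup>2 \<partial>D)\<^sup>2)"

text \<open>
  The second parameter is the variance; variance \<open>0\<close> gives the point mass, which is needed
  for linear functionals in the kernel of a singular covariance matrix.
\<close>

definition normal_law :: "real \<Rightarrow> real \<Rightarrow> real measure" where
  "normal_law a s2 =
     (if s2 = 0 then return borel a
      else density lborel (\<lambda>x. ennreal (normal_density a (sqrt s2) x)))"

text \<open>
  \<open>D = N(\<mu>, S)\<close> for a symmetric positive semidefinite \<open>S\<close>: every linear functional
  \<open>v\<^sup>T x\<close> is distributed as \<open>N(v\<^sup>T \<mu>, v\<^sup>T S v)\<close>.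
\<close>

definition gaussian ::
  "nat \<Rightarrow> (nat \<Rightarrow> real) \<Rightarrow> (nat \<Rightarrow> nat \<Rightarrow> real) \<Rightarrow> (nat \<Rightarrow> real) measure \<Rightarrow> bool" where
  "gaussian n \<mu> S D \<longleftrightarrow>
     (\<forall>i<n. \<forall>j<n. S i j = S j i) \<and>
     (\<forall>v. 0 \<le> dotp n v (mat_apply n S v)) \<and>
     (\<forall>v. distr D borel (dotp n v) = normal_law (dotp n v \<mu>) (dotp n v (mat_apply n S v)))"


definition samples :: "nat \<Rightarrow> nat \<Rightarrow> (nat \<Rightarrow> nat \<Rightarrow> real) measure" where
  "samples n m = PiM {..<m} (\<lambda>_. Rn n)"

text \<open>
  The adversary sees all clean samples and which of them are corrupted (flag \<^term>\<open>True\<close>)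
  and then chooses the replacements, jointly and possibly at random: it is a Markov kernel.
  A possibly randomized algorithm is a Markov kernel from samples to estimates.
\<close>

definition adversaries ::
  "nat \<Rightarrow> nat \<Rightarrow> ((nat \<Rightarrow> (nat \<Rightarrow> real) \<times> bool) \<Rightarrow> (nat \<Rightarrow> nat \<Rightarrow> real) measure) set" where
  "adversaries n m =
     measurable (PiM {..<m} (\<lambda>_. Rn n \<Otimes>\<^sub>M count_space UNIV)) (prob_algebra (samples n m))"

definition algorithms ::
  "nat \<Rightarrow> nat \<Rightarrow> ((nat \<Rightarrow> nat \<Rightarrow> real) \<Rightarrow> (nat \<Rightarrow> real) measure) set" where
  "algorithms n m = measurable (samples n m) (prob_algebra (Rn n))"

text \<open>The joint law of \<open>m\<close> samples from \<open>D\<^sub>\<eta>\<close> against the adversary \<open>A\<close>.\<close>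

definition noisy_samples ::
  "nat \<Rightarrow> nat \<Rightarrow> real \<Rightarrow> (nat \<Rightarrow> real) measure \<Rightarrow>
   ((nat \<Rightarrow> (nat \<Rightarrow> real) \<times> bool) \<Rightarrow> (nat \<Rightarrow> nat \<Rightarrow> real) measure) \<Rightarrow>
   (nat \<Rightarrow> nat \<Rightarrow> real) measure" where
  "noisy_samples n m \<eta> D A =
     PiM {..<m} (\<lambda>_. D \<Otimes>\<^sub>M measure_pmf (bernoulli_pmf \<eta>)) \<bind> (\<lambda>w.
       A w \<bind> (\<lambda>a.
         return (samples n m) (\<lambda>i\<in>{..<m}. if snd (w i) then a i else fst (w i))))"

definition error_prob ::
  "nat \<Rightarrow> nat \<Rightarrow> real \<Rightarrow> (nat \<Rightarrow> real) measure \<Rightarrow>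
   ((nat \<Rightarrow> (nat \<Rightarrow> real) \<times> bool) \<Rightarrow> (nat \<Rightarrow> nat \<Rightarrow> real) measure) \<Rightarrow>
   ((nat \<Rightarrow> nat \<Rightarrow> real) \<Rightarrow> (nat \<Rightarrow> real) measure) \<Rightarrow> (nat \<Rightarrow> real) \<Rightarrow> real \<Rightarrow> real" where
  "error_prob n m \<eta> D A E \<mu> r =
     measure (noisy_samples n m \<eta> D A \<bind> E)
       {e \<in> space (Rn n). r \<le> L2_set (\<lambda>i. \<mu> i - e i) {..<n}}"

end

theory Submission
  imports Defs
begin

text \<open>
  Two distributions \<open>D\<^sub>1, D\<^sub>2\<close> cannot be told apart once there are noise distributions
  \<open>Q\<^sub>1, Q\<^sub>2\<close> with \<open>(1 - \<eta>) D\<^sub>1 + \<eta> Q\<^sub>1 = (1 - \<eta>) D\<^sub>2 + \<eta> Q\<^sub>2\<close>: an adversary that ignores the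
  clean data and replaces corrupted samples by independent draws from \<open>Q\<^sub>i\<close> produces the same
  law of the samples in both cases, and for one of the two the estimate is off by half the distance of the
  means with probability at least \<open>1/2\<close>. For Gaussians, such \<open>Q\<^sub>i\<close> exist for \<open>N(0, 1)\<close> and
  \<open>N(\<eta>, 1)\<close>, whose total variation distance is at most \<open>\<eta>\<close>. For bounded fourth moments, take
  the uniform distribution on \<open>{-1, 1}\<close> with an additional atom of mass \<open>p = \<eta> / (1 - \<eta>)\<close>
  at \<open>\<eta> powr (-1/4)\<close> or at its negative; the noise supplies the other atom. In dimension
  \<open>n\<close> everything is placed on the first coordinate axis, with a covariance of rank one.
\<close>

section \<open>Law of the noisy samples under an adversary that ignores the data\<close>

text \<open>Flag, clean value and replacement are independent across the indices, so the noisy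
  samples are independent draws from the mixture of \<open>D\<close> and \<open>Q\<close> with
  weights \<open>1 - \<eta>\<close> and \<open>\<eta>\<close>. The second claim expresses this on
  boxes, which determine the law; the first gives the typing needed to bind an algorithm to
  it.\<close>

lemma noisy_samples_iid_adversary:
  assumes D: "D \<in> space (prob_algebra (Rn n))" and Q: "Q \<in> space (prob_algebra (Rn n))"
    and \<eta>: "0 \<le> \<eta>" "\<eta> \<le> 1" and X: "\<And>i. i < m \<Longrightarrow> X i \<in> sets (Rn n)"
  shows "noisy_samples n m \<eta> D (\<lambda>_. PiM {..<m} (\<lambda>_. Q)) \<in> space (prob_algebra (samples n m))"
    and "emeasure (noisy_samples n m \<eta> D (\<lambda>_. PiM {..<m} (\<lambda>_. Q))) (Pi\<^sub>E {..<m} X) =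
         (\<Prod>i<m. ennreal (1 - \<eta>) * emeasure D (X i) + ennreal \<eta> * emeasure Q (X i))"
proof -
  let ?B = "measure_pmf (bernoulli_pmf \<eta>)"
  let ?W = "PiM {..<m} (\<lambda>_. D \<Otimes>\<^sub>M ?B)" and ?P = "PiM {..<m} (\<lambda>_. Q)"
  let ?mix = "\<lambda>w a. \<lambda>i\<in>{..<m}. if snd (w i) then a i else fst (w i)"
  have [measurable_cong]: "sets D = sets (Rn n)" "sets Q = sets (Rn n)"
    using D Q by (auto simp: space_prob_algebra)
  interpret D: prob_space D using D by (simp add: space_prob_algebra)
  interpret Q: prob_space Q using Q by (simp add: space_prob_algebra)
  interpret DB: prob_space "D \<Otimes>\<^sub>M ?B" by (intro prob_space_pair D.prob_space_axioms prob_space_measure_pmf)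
  interpret Qs: product_sigma_finite "\<lambda>_. Q" by standard
  interpret DBs: product_sigma_finite "\<lambda>_. D \<Otimes>\<^sub>M ?B" by standard
  have W: "?W \<in> space (prob_algebra ?W)"
    by (auto simp: space_prob_algebra intro!: prob_space_PiM DB.prob_space_axioms)
  have P: "?P \<in> space (prob_algebra (samples n m))"
    using Q by (auto simp: space_prob_algebra samples_def intro!: prob_space_PiM sets_PiM_cong)
  have mix: "(\<lambda>(w, a). ?mix w a) \<in> ?W \<Otimes>\<^sub>M samples n m \<rightarrow>\<^sub>M samples n m"
    unfolding samples_def by measurable
  have ret: "(\<lambda>(w, a). return (samples n m) (?mix w a)) \<in> ?W \<Otimes>\<^sub>M samples n m \<rightarrow>\<^sub>M prob_algebra (samples n m)"
    using measurable_compose[OF mix measurable_return_prob_space] by (simp add: case_prod_beta)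
  have K: "(\<lambda>w. ?P \<bind> (\<lambda>a. return (samples n m) (?mix w a))) \<in> ?W \<rightarrow>\<^sub>M prob_algebra (samples n m)"
    by (rule measurable_bind_prob_space2[OF measurable_const[OF P] ret])
  show "noisy_samples n m \<eta> D (\<lambda>_. ?P) \<in> space (prob_algebra (samples n m))"
    unfolding noisy_samples_def using prob_space_bind'[OF W K] sets_bind'[OF W K]
    by (simp add: space_prob_algebra)
  have box: "Pi\<^sub>E {..<m} X \<in> sets (samples n m)"
    unfolding samples_def using X by (intro sets_PiM_I_finite) auto
  \<comment> \<open>With clean data and flags \<open>w\<close> fixed, only the replacements are
    random. They are independent, so the box probability is a product: a corrupted index contributes
    the mass under \<open>Q\<close>, a clean one an indicator.\<close>
  have inner: "emeasure (?P \<bind> (\<lambda>a. return (samples n m) (?mix w a))) (Pi\<^sub>E {..<m} X) =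
      (\<Prod>i<m. if snd (w i) then emeasure Q (X i) else indicator (X i) (fst (w i)))"
    if w: "w \<in> space ?W" for w
  proof -
    have "emeasure (?P \<bind> (\<lambda>a. return (samples n m) (?mix w a))) (Pi\<^sub>E {..<m} X) =
        (\<integral>\<^sup>+a. emeasure (return (samples n m) (?mix w a)) (Pi\<^sub>E {..<m} X) \<partial>?P)"
      using measurable_compose[OF measurable_Pair1'[OF w] ret]
      by (intro emeasure_bind_prob_algebra[OF P _ box]) simp
    also have "\<dots> = (\<integral>\<^sup>+a. (\<Prod>i<m. indicator (X i) (if snd (w i) then a i else fst (w i))) \<partial>?P)"
      using box by (intro nn_integral_cong)
        (auto simp: PiE_iff indicator_def intro!: prod.neutral)
    also have "\<dots> = (\<Prod>i<m. \<integral>\<^sup>+y. indicator (X i) (if snd (w i) then y else fst (w i)) \<partial>Q)"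
    proof (intro Qs.product_nn_integral_prod)
      fix i assume "i \<in> {..<m}"
      then have [measurable]: "X i \<in> sets Q" using X Q by (simp add: space_prob_algebra)
      show "(\<lambda>y. indicator (X i) (if snd (w i) then y else fst (w i))) \<in> borel_measurable Q"
        by (cases "snd (w i)") auto
    qed auto
    also have "\<dots> = (\<Prod>i<m. if snd (w i) then emeasure Q (X i) else indicator (X i) (fst (w i)))"
      using X by (intro prod.cong) (auto simp: Q.emeasure_space_1)
    finally show ?thesis .
  qed
  have "emeasure (noisy_samples n m \<eta> D (\<lambda>_. ?P)) (Pi\<^sub>E {..<m} X) =
      (\<integral>\<^sup>+w. (\<Prod>i<m. if snd (w i) then emeasure Q (X i) else indicator (X i) (fst (w i))) \<partial>?W)"
    unfolding noisy_samples_def emeasure_bind_prob_algebra[OF W K box]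
    by (intro nn_integral_cong inner)
  \<comment> \<open>Second use of independence: the \<open>i\<close>-th factor depends on
    \<open>w\<close> only through the pair \<open>w i\<close>.\<close>
  also have "\<dots> = (\<Prod>i<m. \<integral>\<^sup>+z. (if snd z then emeasure Q (X i) else indicator (X i) (fst z)) \<partial>(D \<Otimes>\<^sub>M ?B))"
  proof (intro DBs.product_nn_integral_prod)
    fix i assume "i \<in> {..<m}"
    then have [measurable]: "X i \<in> sets (Rn n)" using X by simp
    show "(\<lambda>z. if snd z then emeasure Q (X i) else indicator (X i) (fst z)) \<in> borel_measurable (D \<Otimes>\<^sub>M ?B)"
      by measurable
  qed auto
  also have "\<dots> = (\<Prod>i<m. ennreal (1 - \<eta>) * emeasure D (X i) + ennreal \<eta> * emeasure Q (X i))"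
  proof (intro prod.cong refl)
    fix i assume "i \<in> {..<m}"
    then have [measurable]: "X i \<in> sets (Rn n)" using X by simp
    have "(\<integral>\<^sup>+z. (if snd z then emeasure Q (X i) else indicator (X i) (fst z)) \<partial>(D \<Otimes>\<^sub>M ?B)) =
        (\<integral>\<^sup>+x. \<integral>\<^sup>+b. (if b then emeasure Q (X i) else indicator (X i) x) \<partial>?B \<partial>D)"
      by (subst measure_pmf.nn_integral_fst[symmetric]) (measurable, simp only: fst_conv snd_conv)
    also have "\<dots> = (\<integral>\<^sup>+x. emeasure Q (X i) * ennreal \<eta> + ennreal (1 - \<eta>) * indicator (X i) x \<partial>D)"
      using \<eta> by (simp add: mult.commute)
    also have "\<dots> = ennreal (1 - \<eta>) * emeasure D (X i) + ennreal \<eta> * emeasure Q (X i)"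
      by (simp add: nn_integral_add nn_integral_cmult D.emeasure_space_1 ac_simps)
    finally show "(\<integral>\<^sup>+z. (if snd z then emeasure Q (X i) else indicator (X i) (fst z)) \<partial>(D \<Otimes>\<^sub>M ?B)) =
      ennreal (1 - \<eta>) * emeasure D (X i) + ennreal \<eta> * emeasure Q (X i)" .
  qed
  finally show "emeasure (noisy_samples n m \<eta> D (\<lambda>_. ?P)) (Pi\<^sub>E {..<m} X) =
         (\<Prod>i<m. ennreal (1 - \<eta>) * emeasure D (X i) + ennreal \<eta> * emeasure Q (X i))" .
qed

section \<open>Laws on the line, embedded on the first coordinate axis\<close>

text \<open>The lambda is restricted to \<open>{..<n}\<close> because the points of
  \<open>Rn n\<close> are extensional functions.\<close>

definition axis_embed :: "nat \<Rightarrow> real \<Rightarrow> nat \<Rightarrow> real" where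
  "axis_embed n x = (\<lambda>i\<in>{..<n}. if i = 0 then x else 0)"

definition first_diag :: "real \<Rightarrow> nat \<Rightarrow> nat \<Rightarrow> real" where
  "first_diag V i j = (if i = 0 \<and> j = 0 then V else 0)"

lemma measurable_axis_embed [measurable]: "axis_embed n \<in> borel \<rightarrow>\<^sub>M Rn n"
  unfolding axis_embed_def Rn_def by measurable

lemma mat_apply_first_diag:
  assumes "1 \<le> n"
  shows "mat_apply n (first_diag V) v = (\<lambda>i. if i = 0 then V * v 0 else 0)"
proof
  fix i
  have "mat_apply n (first_diag V) v i = (\<Sum>j<n. if j = 0 then first_diag V i 0 * v 0 else 0)"
    unfolding mat_apply_def first_diag_def by (intro sum.cong) auto
  with assms show "mat_apply n (first_diag V) v i = (if i = 0 then V * v 0 else 0)"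
    by (simp add: first_diag_def)
qed

lemma L2_set_first:
  fixes n :: nat
  assumes "1 \<le> n"
  shows "L2_set (\<lambda>i. if i = 0 then x else 0) {..<n} = \<bar>x\<bar>"
proof -
  have "(\<Sum>i<n. (if i = 0 then x else 0)\<^sup>2) = (\<Sum>i<n. if i = 0 then x\<^sup>2 else 0)"
    by (intro sum.cong) auto
  also have "\<dots> = x\<^sup>2" using assms by simp
  finally show ?thesis by (simp add: L2_set_def)
qed

text \<open>The supremum is attained at the first basis vector: a unit vector \<open>v\<close> is
  sent to a vector of norm \<open>V * \<bar>v 0\<bar>\<close>, and a coordinate is bounded by the
  norm.\<close>

lemma op_norm_first_diag:
  assumes "1 \<le> n" "0 \<le> V"
  shows "op_norm n (first_diag V) = V"
  unfolding op_norm_def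
proof (rule cSup_eq_maximum)
  have "L2_set (mat_apply n (first_diag V) (\<lambda>i. if i = 0 then 1 else 0)) {..<n} = V"
    using assms by (simp add: mat_apply_first_diag L2_set_first)
  then show "V \<in> (\<lambda>v. L2_set (mat_apply n (first_diag V) v) {..<n}) ` {v. L2_set v {..<n} = 1}"
    using L2_set_first[OF assms(1), of 1] by (intro image_eqI[of _ _ "\<lambda>i. if i = 0 then 1 else 0"]) auto
  fix y assume "y \<in> (\<lambda>v. L2_set (mat_apply n (first_diag V) v) {..<n}) ` {v. L2_set v {..<n} = 1}"
  then obtain v where v: "L2_set v {..<n} = 1" and y: "y = V * \<bar>v 0\<bar>"
    using assms by (auto simp: mat_apply_first_diag L2_set_first abs_mult)
  have "\<bar>v 0\<bar> \<le> L2_set (\<lambda>i. \<bar>v i\<bar>) {..<n}"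
    using assms by (intro member_le_L2_set) auto
  with v have "\<bar>v 0\<bar> \<le> 1" by (simp add: L2_set_def)
  then show "y \<le> V" using y assms by (simp add: mult_left_le)
qed

lemma dotp_axis_embed:
  "1 \<le> n \<Longrightarrow> dotp n v (axis_embed n x) = v 0 * x"
  "1 \<le> n \<Longrightarrow> dotp n (\<lambda>i. axis_embed n x i - axis_embed n a i) v = (x - a) * v 0"
proof -
  assume n: "1 \<le> n"
  have "dotp n v (axis_embed n x) = (\<Sum>i<n. if i = 0 then v 0 * x else 0)"
    unfolding dotp_def axis_embed_def by (intro sum.cong) auto
  with n show "dotp n v (axis_embed n x) = v 0 * x" by simp
  have "dotp n (\<lambda>i. axis_embed n x i - axis_embed n a i) v = (\<Sum>i<n. if i = 0 then (x - a) * v 0 else 0)"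
    unfolding dotp_def axis_embed_def by (intro sum.cong) auto
  with n show "dotp n (\<lambda>i. axis_embed n x i - axis_embed n a i) v = (x - a) * v 0" by simp
qed

lemma measurable_dotp [measurable]: "dotp n v \<in> Rn n \<rightarrow>\<^sub>M borel"
  unfolding dotp_def Rn_def by measurable

lemma measurable_Rn_component: "i < n \<Longrightarrow> (\<lambda>x. x i) \<in> Rn n \<rightarrow>\<^sub>M borel"
  unfolding Rn_def by (rule measurable_component_singleton) simp

lemma distr_axis_embed_in_prob_algebra:
  assumes "N \<in> space (prob_algebra borel)"
  shows "distr N (Rn n) (axis_embed n) \<in> space (prob_algebra (Rn n))"
proof -
  have "axis_embed n \<in> N \<rightarrow>\<^sub>M Rn n"
    using measurable_axis_embed assms by (simp add: space_prob_algebra cong: measurable_cong_sets)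
  with assms show ?thesis by (auto simp: space_prob_algebra intro!: prob_space.prob_space_distr)
qed

lemma distribution_on_axis_embed:
  "N \<in> space (prob_algebra borel) \<Longrightarrow> distribution_on n (distr N (Rn n) (axis_embed n))"
  using distr_axis_embed_in_prob_algebra[of N n] by (simp add: distribution_on_def space_prob_algebra)

text \<open>All coordinates but the first are constantly 0, so every moment that involves one of
  them vanishes; the remaining ones are those of \<open>N\<close>.\<close>

lemma has_mean_cov_axis_embed:
  assumes N: "sets N = sets borel"
    and int: "integrable N (\<lambda>x. x)" "integrable N (\<lambda>x. x\<^sup>2)"
    and mean: "(\<integral>x. x \<partial>N) = a" and var: "(\<integral>x. (x - a)\<^sup>2 \<partial>N) = V"
  shows "has_mean_cov n (distr N (Rn n) (axis_embed n)) (axis_embed n a) (first_diag V)"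
proof -
  have emb: "axis_embed n \<in> N \<rightarrow>\<^sub>M Rn n"
    using measurable_axis_embed N by (simp cong: measurable_cong_sets)
  note comp = measurable_Rn_component[of _ n]
  show ?thesis
    unfolding has_mean_cov_def
  proof (intro conjI allI impI)
    fix i assume i: "i < n"
    show "integrable (distr N (Rn n) (axis_embed n)) (\<lambda>x. x i)"
      unfolding integrable_distr_eq[OF emb comp[OF i]]
      using i int by (cases "i = 0") (simp_all add: axis_embed_def)
    show "integrable (distr N (Rn n) (axis_embed n)) (\<lambda>x. (x i)\<^sup>2)"
      unfolding integrable_distr_eq[OF emb borel_measurable_power[OF comp[OF i]]]
      using i int by (cases "i = 0") (simp_all add: axis_embed_def)
    show "axis_embed n a i = (\<integral>x. x i \<partial>distr N (Rn n) (axis_embed n))"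
      unfolding integral_distr[OF emb comp[OF i]]
      using i mean by (cases "i = 0") (simp_all add: axis_embed_def)
    fix j assume j: "j < n"
    have "(\<lambda>x. (x i - axis_embed n a i) * (x j - axis_embed n a j)) \<in> borel_measurable (Rn n)"
      by (intro borel_measurable_times borel_measurable_diff comp i j borel_measurable_const)
    from integral_distr[OF emb this]
    show "first_diag V i j = (\<integral>x. (x i - axis_embed n a i) * (x j - axis_embed n a j) \<partial>distr N (Rn n) (axis_embed n))"
      using i j var by (cases "i = 0"; cases "j = 0") (simp_all add: axis_embed_def first_diag_def power2_eq_square)
  qed
qed

text \<open>In direction \<open>v\<close> the centred variable is \<open>(x - a) * v 0\<close>, so
  both sides of the inequality scale by \<open>v 0 ^ 4\<close>.\<close>

lemma bounded_fourth_moments_axis_embed: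
  assumes n: "1 \<le> n" and N: "sets N = sets borel"
    and int: "integrable N (\<lambda>x. (x - a) ^ 4)"
    and kurt: "(\<integral>x. (x - a) ^ 4 \<partial>N) \<le> C4 * (\<integral>x. (x - a)\<^sup>2 \<partial>N)\<^sup>2"
  shows "bounded_fourth_moments n C4 (distr N (Rn n) (axis_embed n)) (axis_embed n a)"
proof -
  have emb: "axis_embed n \<in> N \<rightarrow>\<^sub>M Rn n"
    using measurable_axis_embed N by (simp cong: measurable_cong_sets)
  have pow: "(\<lambda>x. dotp n (\<lambda>i. x i - axis_embed n a i) v ^ k) \<in> borel_measurable (Rn n)" for v k
    unfolding dotp_def Rn_def by measurable
  show ?thesis
    unfolding bounded_fourth_moments_def
  proof (intro allI impI conjI)
    fix v :: "nat \<Rightarrow> real"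
    show "integrable (distr N (Rn n) (axis_embed n)) (\<lambda>x. dotp n (\<lambda>i. x i - axis_embed n a i) v ^ 4)"
      using n int by (simp add: integrable_distr_eq[OF emb pow] dotp_axis_embed power_mult_distrib)
    have "v 0 ^ 4 * (\<integral>x. (x - a) ^ 4 \<partial>N) \<le> v 0 ^ 4 * (C4 * (\<integral>x. (x - a)\<^sup>2 \<partial>N)\<^sup>2)"
      by (intro mult_left_mono kurt) simp
    then show "(\<integral>x. dotp n (\<lambda>i. x i - axis_embed n a i) v ^ 4 \<partial>distr N (Rn n) (axis_embed n))
        \<le> C4 * (\<integral>x. (dotp n (\<lambda>i. x i - axis_embed n a i) v)\<^sup>2 \<partial>distr N (Rn n) (axis_embed n))\<^sup>2"
      using n by (simp add: integral_distr[OF emb pow] dotp_axis_embed power_mult_distrib power_mult[symmetric] mult_ac)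
  qed
qed

text \<open>A functional \<open>v\<close> sees only \<open>v 0 * x\<close>, a multiple of a normal
  variable. If \<open>v 0 = 0\<close>, this is the point mass at 0, the variance 0 case of
  \<open>normal_law\<close>.\<close>

lemma gaussian_axis_embed:
  assumes n: "1 \<le> n"
  shows "gaussian n (axis_embed n a) (first_diag 1)
           (distr (density lborel (normal_density a 1)) (Rn n) (axis_embed n))"
proof -
  let ?N = "density lborel (normal_density a 1)"
  interpret N: prob_space ?N by (rule prob_space_normal_density) simp
  have quad: "dotp n v (mat_apply n (first_diag 1) v) = (v 0)\<^sup>2" for v
  proof -
    have "dotp n v (mat_apply n (first_diag 1) v) = (\<Sum>i<n. if i = 0 then (v 0)\<^sup>2 else 0)"
      using n unfolding dotp_def mat_apply_first_diag[OF n] by (intro sum.cong) (auto simp: power2_eq_square)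
    with n show ?thesis by simp
  qed
  have id: "distributed ?N lborel (\<lambda>x. x) (normal_density a 1)"
    by (auto simp: distributed_def distr_id2)
  have law: "distr ?N borel (\<lambda>x. v * x) = normal_law (v * a) (v\<^sup>2)" for v
  proof (cases "v = 0")
    case False
    \<comment> \<open>The affine rule for normal densities has \<open>lborel\<close> as target
      space; it has the same measurable sets, so the push-forward does not change.\<close>
    have "distr ?N borel (\<lambda>x. v * x) = distr ?N lborel (\<lambda>x. v * x)"
      by (rule distr_cong) auto
    with N.normal_density_affine[OF id _ False, of 0] False show ?thesis
      by (simp add: normal_law_def distributed_def)
  qed (simp add: normal_law_def)
  have "distr (distr ?N (Rn n) (axis_embed n)) borel (dotp n v) = distr ?N borel (\<lambda>x. v 0 * x)" for v
    using n by (subst distr_distr) (auto simp: comp_def dotp_axis_embed)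
  then show ?thesis
    unfolding gaussian_def using n law by (auto simp: quad dotp_axis_embed first_diag_def)
qed

section \<open>The two-point argument\<close>

text \<open>This is Le Cam's two-point method in its extreme case: both hypotheses give the same law
  of the estimate, every estimate is at distance at least \<open>r\<close> from one of the two
  means, and so one of the two error events has probability at least \<open>1 / 2\<close>.\<close>

lemma indistinguishable_pair_lower_bound:
  fixes D Q :: "bool \<Rightarrow> real measure" and a :: "bool \<Rightarrow> real"
  assumes n: "1 \<le> n" and \<eta>: "0 \<le> \<eta>" "\<eta> \<le> 1" and E: "E \<in> algorithms n m"
    and D: "\<And>b. D b \<in> space (prob_algebra borel)" and Q: "\<And>b. Q b \<in> space (prob_algebra borel)"
    and mix: "\<And>X. X \<in> sets borel \<Longrightarrow>
      ennreal (1 - \<eta>) * emeasure (D True) X + ennreal \<eta> * emeasure (Q True) X =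
      ennreal (1 - \<eta>) * emeasure (D False) X + ennreal \<eta> * emeasure (Q False) X"
    and sep: "2 * r \<le> \<bar>a True - a False\<bar>"
  shows "\<exists>b. \<exists>A \<in> adversaries n m.
    1 / 2 \<le> error_prob n m \<eta> (distr (D b) (Rn n) (axis_embed n)) A E (axis_embed n (a b)) r"
proof -
  define D' where "D' b = distr (D b) (Rn n) (axis_embed n)" for b
  define Q' where "Q' b = distr (Q b) (Rn n) (axis_embed n)" for b
  define A :: "bool \<Rightarrow> (nat \<Rightarrow> (nat \<Rightarrow> real) \<times> bool) \<Rightarrow> (nat \<Rightarrow> nat \<Rightarrow> real) measure"
    where "A b = (\<lambda>_. PiM {..<m} (\<lambda>_. Q' b))" for b
  define N where "N b = noisy_samples n m \<eta> (D' b) (A b)" for b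
  have D': "D' b \<in> space (prob_algebra (Rn n))" for b
    unfolding D'_def by (rule distr_axis_embed_in_prob_algebra[OF D])
  have Q': "Q' b \<in> space (prob_algebra (Rn n))" for b
    unfolding Q'_def by (rule distr_axis_embed_in_prob_algebra[OF Q])
  have sets: "sets (D' b) = sets (Rn n)" "sets (Q' b) = sets (Rn n)" for b
    by (simp_all add: D'_def Q'_def)
  have A: "A b \<in> adversaries n m" for b
    unfolding A_def adversaries_def using Q'[of b]
    by (intro measurable_const) (auto simp: space_prob_algebra samples_def intro!: prob_space_PiM sets_PiM_cong)
  have N: "N b \<in> space (prob_algebra (samples n m))" for b
    unfolding N_def A_def by (rule noisy_samples_iid_adversary(1)[OF D' Q' \<eta>, where X="\<lambda>_. {}"]) simp
  \<comment> \<open>Taking preimages under the embedding reduces events in \<open>Rn n\<close> to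
    Borel sets of the line, where \<open>mix\<close> applies.\<close>
  have pull: "emeasure (distr M (Rn n) (axis_embed n)) X = emeasure M (axis_embed n -` X)"
    "axis_embed n -` X \<in> sets borel"
    if "M \<in> space (prob_algebra borel)" "X \<in> sets (Rn n)" for M X
  proof -
    have M: "sets M = sets borel" using that by (simp add: space_prob_algebra)
    have "axis_embed n \<in> M \<rightarrow>\<^sub>M Rn n"
      using measurable_axis_embed M by (simp cong: measurable_cong_sets)
    then show "emeasure (distr M (Rn n) (axis_embed n)) X = emeasure M (axis_embed n -` X)"
      using that sets_eq_imp_space_eq[OF M] by (simp add: emeasure_distr)
    show "axis_embed n -` X \<in> sets borel"
      using measurable_sets[OF measurable_axis_embed that(2)] by simp
  qed
  have same: "N True = N False"
  \<comment> \<open>Boxes generate the product sets and are stable under intersection. Since the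
    laws are finite, the constant sequence of the whole space can serve as the exhausting
    sequence.\<close>
  proof (rule measure_eqI_PiM_finite[where I="{..<m}" and M="\<lambda>_. Rn n" and A="\<lambda>_. space (samples n m)"])
    fix X :: "nat \<Rightarrow> (nat \<Rightarrow> real) set" assume X: "\<And>i. i \<in> {..<m} \<Longrightarrow> X i \<in> sets (Rn n)"
    have box: "emeasure (N b) (Pi\<^sub>E {..<m} X) =
        (\<Prod>i<m. ennreal (1 - \<eta>) * emeasure (D b) (axis_embed n -` X i) + ennreal \<eta> * emeasure (Q b) (axis_embed n -` X i))" for b
      unfolding N_def A_def using X D Q
      by (subst noisy_samples_iid_adversary(2)[OF D' Q' \<eta>]) (auto simp: D'_def Q'_def pull(1) intro!: prod.cong)
    show "emeasure (N True) (Pi\<^sub>E {..<m} X) = emeasure (N False) (Pi\<^sub>E {..<m} X)"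
      unfolding box using X D pull(2) by (intro prod.cong refl mix) blast
  next
    show "sets (N True) = sets (PiM {..<m} (\<lambda>_. Rn n))" "sets (N False) = sets (PiM {..<m} (\<lambda>_. Rn n))"
      using N by (auto simp: space_prob_algebra samples_def)
    interpret prob_space "N True" using N by (simp add: space_prob_algebra)
    show "emeasure (N True) (space (samples n m)) \<noteq> \<infinity>" by simp
    show "range (\<lambda>_. space (samples n m)) \<subseteq> prod_algebra {..<m} (\<lambda>_. Rn n)"
      by (auto simp: samples_def space_PiM intro!: prod_algebraI_finite)
  qed (auto simp: samples_def)
  define L where "L = N True \<bind> E"
  have E': "E \<in> samples n m \<rightarrow>\<^sub>M prob_algebra (Rn n)" using E by (simp add: algorithms_def)
  interpret L: prob_space L unfolding L_def by (rule prob_space_bind'[OF N E'])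
  have L_sets: "sets L = sets (Rn n)" unfolding L_def by (rule sets_bind'[OF N E'])
  let ?F = "\<lambda>b. {e \<in> space (Rn n). r \<le> L2_set (\<lambda>i. axis_embed n (a b) i - e i) {..<n}}"
  have F: "?F b \<in> sets L" for b
    unfolding L_sets L2_set_def Rn_def by measurable
  have "space L \<subseteq> ?F True \<union> ?F False"
  proof
    fix e assume e: "e \<in> space L"
    \<comment> \<open>The means differ only in coordinate 0, so the separation can be read off
      there: an estimate cannot have \<open>e 0\<close> closer than \<open>r\<close> to both
      \<open>a True\<close> and \<open>a False\<close>.\<close>
    have "\<bar>a b - e 0\<bar> \<le> L2_set (\<lambda>i. axis_embed n (a b) i - e i) {..<n}" for b
      using n member_le_L2_set[of "{..<n}" 0 "\<lambda>i. \<bar>axis_embed n (a b) i - e i\<bar>"]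
      by (simp add: axis_embed_def L2_set_def)
    from this[of True] this[of False] sep
    have "r \<le> L2_set (\<lambda>i. axis_embed n (a True) i - e i) {..<n} \<or> r \<le> L2_set (\<lambda>i. axis_embed n (a False) i - e i) {..<n}"
      by linarith
    then show "e \<in> ?F True \<union> ?F False"
      using e sets_eq_imp_space_eq[OF L_sets] by auto
  qed
  then have "1 \<le> L.prob (?F True \<union> ?F False)"
    using L.finite_measure_mono[of "space L" "?F True \<union> ?F False"] F L.prob_space by auto
  also have "\<dots> \<le> L.prob (?F True) + L.prob (?F False)"
    by (intro measure_Un_le F)
  finally have "1 / 2 \<le> L.prob (?F True) \<or> 1 / 2 \<le> L.prob (?F False)" by linarith
  moreover have "L.prob (?F b) = error_prob n m \<eta> (D' b) (A b) E (axis_embed n (a b)) r" for b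
    using same by (cases b) (simp_all add: error_prob_def L_def N_def)
  ultimately show ?thesis using A unfolding D'_def by metis
qed

section \<open>Common mixtures of densities and the Gaussian pair\<close>

lemma prob_space_density_real:
  assumes "integrable M f" "\<And>x. 0 \<le> f x" "(\<integral>x. f x \<partial>M) = (1::real)"
  shows "prob_space (density M (\<lambda>x. ennreal (f x)))"
proof
  show "emeasure (density M (\<lambda>x. ennreal (f x))) (space (density M (\<lambda>x. ennreal (f x)))) = 1"
    using assms by (simp add: emeasure_density nn_integral_eq_integral)
qed

text \<open>The target mixture has density \<open>h / Z\<close> with \<open>Z\<close> the mass of
  \<open>h\<close>. From \<open>Z \<le> 1 + \<eta>\<close> and
  \<open>(1 - \<eta>) * (1 + \<eta>) \<le> 1\<close> it follows that \<open>(1 - \<eta>) * f\<close>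
  lies below this density; the difference has mass \<open>\<eta>\<close> and, divided by
  \<open>\<eta>\<close>, is the density of \<open>Q\<close>. The target depends on \<open>h\<close>
  alone, so two densities below the same \<open>h\<close> are completed to the same mixture.\<close>

lemma complete_to_common_mixture:
  assumes f: "integrable M f" "\<And>x. 0 \<le> f x" "(\<integral>x. f x \<partial>M) = 1"
    and h: "integrable M h" "\<And>x. f x \<le> h x" "(\<integral>x. h x \<partial>M) \<le> 1 + \<eta>"
    and \<eta>: "0 < \<eta>" "\<eta> < 1"
  obtains Q where "prob_space Q" "sets Q = sets M"
    "\<And>X. X \<in> sets M \<Longrightarrow>
      ennreal (1 - \<eta>) * emeasure (density M (\<lambda>x. ennreal (f x))) X + ennreal \<eta> * emeasure Q X =
      emeasure (density M (\<lambda>x. ennreal (h x / (\<integral>x. h x \<partial>M)))) X"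
proof
  define Z where "Z = (\<integral>x. h x \<partial>M)"
  have [measurable]: "f \<in> borel_measurable M" "h \<in> borel_measurable M"
    using f h by auto
  have Z1: "1 \<le> Z" unfolding Z_def f(3)[symmetric] using f h by (intro integral_mono) auto
  have "(1 - \<eta>) * Z \<le> (1 - \<eta>) * (1 + \<eta>)" using h(3) \<eta> by (intro mult_left_mono) (auto simp: Z_def)
  also have "\<dots> \<le> 1" by (simp add: algebra_simps)
  finally have "1 - \<eta> \<le> 1 / Z" using Z1 by (simp add: field_simps)
  then have le: "(1 - \<eta>) * f x \<le> h x / Z" for x
    using mult_mono[of "1 - \<eta>" "1 / Z" "f x" "h x"] f(2)[of x] h(2)[of x] Z1 by simp
  let ?q = "\<lambda>x. (h x / Z - (1 - \<eta>) * f x) / \<eta>"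
  let ?Q = "density M (\<lambda>x. ennreal (?q x))"
  have q0: "0 \<le> ?q x" for x using le[of x] \<eta> by simp
  have "(\<integral>x. ?q x \<partial>M) = (Z / Z - (1 - \<eta>) * 1) / \<eta>"
    using f h by (simp add: Z_def)
  also have "\<dots> = 1" using Z1 \<eta> by simp
  finally show "prob_space ?Q"
    using q0 f h by (intro prob_space_density_real) auto
  show "sets ?Q = sets M" by simp
  fix X assume [measurable]: "X \<in> sets M"
  have "ennreal (1 - \<eta>) * emeasure (density M (\<lambda>x. ennreal (f x))) X + ennreal \<eta> * emeasure ?Q X =
     (\<integral>\<^sup>+x. ennreal (1 - \<eta>) * (ennreal (f x) * indicator X x) + ennreal \<eta> * (ennreal (?q x) * indicator X x) \<partial>M)"
    by (simp add: emeasure_density nn_integral_add nn_integral_cmult)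
  also have "\<dots> = (\<integral>\<^sup>+x. ennreal (h x / Z) * indicator X x \<partial>M)"
    using f(2) le \<eta> by (intro nn_integral_cong)
      (auto simp: ennreal_mult'[symmetric] ennreal_plus[symmetric] indicator_def simp del: ennreal_plus)
  finally show "ennreal (1 - \<eta>) * emeasure (density M (\<lambda>x. ennreal (f x))) X + ennreal \<eta> * emeasure ?Q X =
      emeasure (density M (\<lambda>x. ennreal (h x / (\<integral>x. h x \<partial>M)))) X"
    by (simp add: emeasure_density Z_def)
qed

lemma normal_density_shift: "normal_density \<epsilon> \<sigma> x = normal_density 0 \<sigma> (x - \<epsilon>)"
  by (simp add: normal_density_def)

lemma std_normal_density_mono: "\<bar>y\<bar> \<le> \<bar>x\<bar> \<Longrightarrow> std_normal_density x \<le> std_normal_density y"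
  unfolding normal_density_def by (intro mult_left_mono) (auto simp: abs_le_square_iff)

lemma std_normal_density_le_1: "std_normal_density x \<le> 1"
proof -
  have "1 \<le> sqrt (2 * pi)" using pi_gt3 by simp
  then have "exp (- x\<^sup>2 / 2) \<le> sqrt (2 * pi)"
    by (rule order_trans[rotated]) simp
  then show ?thesis by (simp add: normal_density_def field_simps)
qed

text \<open>The integral of the maximum of two probability densities is 1 plus their total variation
  distance. Here that distance is bounded by \<open>\<epsilon>\<close>, which makes the maximum an
  admissible \<open>h\<close> for \<open>complete_to_common_mixture\<close>.\<close>

lemma normal_density_sup:
  assumes "0 \<le> \<epsilon>"
  defines "h \<equiv> \<lambda>x. max (normal_density 0 1 x) (normal_density \<epsilon> 1 x)"
  shows "integrable lborel h" "(\<integral>x. h x \<partial>lborel) \<le> 1 + \<epsilon>"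
proof -
  let ?f = std_normal_density
  show "integrable lborel h" unfolding h_def by (intro integrable_max) auto
  \<comment> \<open>The standard density decreases in the absolute value, and \<open>x\<close> is at
    least as close to 0 as to \<open>\<epsilon>\<close> exactly for
    \<open>x \<le> \<epsilon>/2\<close> when \<open>\<epsilon>\<close> is positive; for
    \<open>\<epsilon> = 0\<close> the two densities coincide.\<close>
  have h: "h x = ?f x * indicator {..\<epsilon>/2} x + ?f (x - \<epsilon>) * indicator {\<epsilon>/2<..} x" for x
    using assms std_normal_density_mono[of x "x - \<epsilon>"] std_normal_density_mono[of "x - \<epsilon>" x]
    by (auto simp: h_def normal_density_shift[of \<epsilon>] indicator_def max_def)
  have fin: "integrable lborel (\<lambda>x. ?f x * indicator A x)" if "A \<in> sets borel" for A
    using that by (intro integrable_real_mult_indicator) auto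
  \<comment> \<open>The form \<open>- \<epsilon> + 1 * x\<close> is the one matched by the affine
    substitution rules for \<open>lborel\<close>.\<close>
  have shift: "(\<lambda>x. ?f (x - \<epsilon>) * indicator {\<epsilon>/2<..} x) = (\<lambda>x. ?f (- \<epsilon> + 1 * x) * indicator {-\<epsilon>/2<..} (- \<epsilon> + 1 * x))"
    by (auto simp: indicator_def fun_eq_iff)
  have shifted: "integrable lborel (\<lambda>x. ?f (x - \<epsilon>) * indicator {\<epsilon>/2<..} x)"
    "(\<integral>x. ?f (x - \<epsilon>) * indicator {\<epsilon>/2<..} x \<partial>lborel) = (\<integral>x. ?f x * indicator {-\<epsilon>/2<..} x \<partial>lborel)"
    unfolding shift
    using lborel_integrable_real_affine[OF fin, of "{-\<epsilon>/2<..}" 1 "- \<epsilon>"]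
      lborel_integral_real_affine[of 1 "\<lambda>x. ?f x * indicator {-\<epsilon>/2<..} x" "- \<epsilon>"] by simp_all
  \<comment> \<open>The densities cross at \<open>\<epsilon>/2\<close>, and after shifting the right half back the two
    halves overlap only on an interval of length \<open>\<epsilon>\<close>, where the density is at most \<open>1\<close>.\<close>
  have "(\<integral>x. h x \<partial>lborel) =
      (\<integral>x. ?f x * indicator {..\<epsilon>/2} x \<partial>lborel) + (\<integral>x. ?f x * indicator {-\<epsilon>/2<..} x \<partial>lborel)"
    unfolding h using fin[of "{..\<epsilon>/2}"] shifted by simp
  also have "\<dots> = (\<integral>x. ?f x * indicator {..\<epsilon>/2} x + ?f x * indicator {-\<epsilon>/2<..} x \<partial>lborel)"
    by (intro Bochner_Integration.integral_add[symmetric] fin) auto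
  also have "\<dots> \<le> (\<integral>x. ?f x + indicator {-\<epsilon>/2<..\<epsilon>/2} x \<partial>lborel)"
    using assms(1) std_normal_density_le_1
    by (intro integral_mono integrable_real_indicator Bochner_Integration.integrable_add fin integrable_normal_density) (auto simp: indicator_def)
  also have "\<dots> = 1 + \<epsilon>"
    using assms(1) by (subst Bochner_Integration.integral_add) auto
  finally show "(\<integral>x. h x \<partial>lborel) \<le> 1 + \<epsilon>" .
qed

lemma normal_moments:
  defines "N \<equiv> (\<lambda>a. density lborel (normal_density a 1))"
  shows "integrable (N a) (\<lambda>x. x)" "integrable (N a) (\<lambda>x. x\<^sup>2)"
    "(\<integral>x. x \<partial>N a) = a" "(\<integral>x. (x - a)\<^sup>2 \<partial>N a) = 1"
proof -
  interpret prob_space "N a" unfolding N_def by (rule prob_space_normal_density) simp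
  have id: "distributed (N a) lborel (\<lambda>x. x) (normal_density a 1)"
    by (auto simp: distributed_def distr_id2 N_def)
  show mean: "(\<integral>x. x \<partial>N a) = a" using normal_distributed_expectation[OF _ id] by simp
  show "(\<integral>x. (x - a)\<^sup>2 \<partial>N a) = 1" using normal_distributed_variance[OF _ id] mean by simp
  show int1: "integrable (N a) (\<lambda>x. x)"
    using integrable_normal_moment_nz_1[of 1 a] by (simp add: N_def integrable_density)
  have "integrable (N a) (\<lambda>x. (x - a)\<^sup>2)"
    using integrable_normal_moment[of 1 a 2] by (simp add: N_def integrable_density)
  \<comment> \<open>The integrand is \<open>x\<^sup>2\<close>, expanded around \<open>a\<close> so
    that the centred moment can be used.\<close>
  then have "integrable (N a) (\<lambda>x. (x - a)\<^sup>2 + 2 * a * x - a\<^sup>2)"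
    using int1 by (intro Bochner_Integration.integrable_diff Bochner_Integration.integrable_add) auto
  then show "integrable (N a) (\<lambda>x. x\<^sup>2)" by (simp add: power2_eq_square algebra_simps)
qed

section \<open>The two-point law with an additional atom\<close>

text \<open>As a \<open>pmf\<close> with at most three atoms, every function is integrable and every
  expectation is a finite sum.\<close>

definition spiked_pmf :: "real \<Rightarrow> real \<Rightarrow> real pmf" where
  "spiked_pmf p t = bind_pmf (bernoulli_pmf p)
     (\<lambda>b. if b then return_pmf t else map_pmf (\<lambda>c. if c then 1 else - 1) (bernoulli_pmf (1 / 2)))"

lemma integrable_spiked_pmf:
  fixes f :: "real \<Rightarrow> real"
  shows "integrable (spiked_pmf p t) f"
  by (intro integrable_measure_pmf_finite) (auto simp: spiked_pmf_def)

lemma integral_spiked_pmf: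
  fixes f :: "real \<Rightarrow> real"
  assumes "0 \<le> p" "p \<le> 1"
  shows "(\<integral>x. f x \<partial>spiked_pmf p t) = p * f t + (1 - p) * (f 1 + f (- 1)) / 2"
  unfolding spiked_pmf_def using assms
  by (subst pmf_expectation_bind[where A=UNIV]) (auto simp: UNIV_bool field_simps)

text \<open>A \<open>pmf\<close> measures all subsets of the line; the push-forward by the identity
  restricts it to the Borel sets, as membership in \<open>prob_algebra borel\<close>
  demands.\<close>

definition spiked_law :: "real \<Rightarrow> real \<Rightarrow> real measure" where
  "spiked_law p t = distr (spiked_pmf p t) borel (\<lambda>x. x)"

lemma spiked_law_in_prob_algebra: "spiked_law p t \<in> space (prob_algebra borel)"
  by (auto simp: spiked_law_def space_prob_algebra intro!: measure_pmf.prob_space_distr)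

lemma integrable_spiked_law:
  "f \<in> borel_measurable borel \<Longrightarrow> integrable (spiked_law p t) (f :: real \<Rightarrow> real)"
  by (simp add: spiked_law_def integrable_distr_eq integrable_spiked_pmf)

lemma integral_spiked_law:
  assumes "0 \<le> p" "p \<le> 1" "f \<in> borel_measurable borel"
  shows "(\<integral>x. f x \<partial>spiked_law p t) = p * f t + (1 - p) * (f 1 + f (- 1)) / (2 :: real)"
  using assms by (simp add: spiked_law_def integral_distr integral_spiked_pmf)

lemma emeasure_spiked_law:
  assumes "0 \<le> p" "p \<le> 1" and X: "X \<in> sets borel"
  shows "emeasure (spiked_law p t) X =
    ennreal (p * indicator X t + (1 - p) * (indicator X 1 + indicator X (- 1)) / 2)"
proof -
  interpret prob_space "spiked_law p t"
    using spiked_law_in_prob_algebra by (simp add: space_prob_algebra)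
  have "prob X = p * indicator X t + (1 - p) * (indicator X 1 + indicator X (- 1)) / 2"
    using integral_spiked_law[of p "indicator X" t] assms by (simp add: spiked_law_def)
  then show ?thesis by (simp only: emeasure_eq_measure)
qed

text \<open>The hypotheses on \<open>t\<close> bound what the atom adds to the second and fourth
  moments, and \<open>a\<close> is small. Atom and bulk each contribute at most 2 to the centred
  fourth moment, while \<open>V\<^sup>2 \<ge> 1 / 4\<close>; this is the source of the constant
  16.\<close>

lemma spiked_law_moments:
  fixes p t :: real
  assumes p: "0 \<le> p" "p \<le> 1 / 8" and t: "p * t\<^sup>2 \<le> 1 / 2" "p * t ^ 4 \<le> 2"
  defines "a \<equiv> p * t" and "V \<equiv> p * t\<^sup>2 + (1 - p) - (p * t)\<^sup>2"
  shows "(\<integral>x. x \<partial>spiked_law p t) = a" "(\<integral>x. (x - a)\<^sup>2 \<partial>spiked_law p t) = V"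
    "1 / 2 \<le> V" "V \<le> 2" "(\<integral>x. (x - a) ^ 4 \<partial>spiked_law p t) \<le> 16 * V\<^sup>2"
proof -
  note int = integral_spiked_law[of p _ t]
  show "(\<integral>x. x \<partial>spiked_law p t) = a" using p by (simp add: int a_def)
  show "(\<integral>x. (x - a)\<^sup>2 \<partial>spiked_law p t) = V"
    using p by (simp add: int a_def V_def) (simp add: field_simps power2_eq_square)
  have "a\<^sup>2 = p * (p * t\<^sup>2)" by (simp add: a_def power2_eq_square)
  also have "\<dots> \<le> 1 / 8 * (1 / 2)" using p t by (intro mult_mono) auto
  finally have a: "a\<^sup>2 \<le> 1 / 16" by simp
  have "0 \<le> p * t\<^sup>2" "0 \<le> a\<^sup>2" using p by auto
  then show V: "1 / 2 \<le> V" "V \<le> 2"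
    using a p t unfolding V_def a_def[symmetric] by linarith+
  \<comment> \<open>Since \<open>a = p * t\<close>, the atom lies at distance
    \<open>(1 - p) * \<bar>t\<bar>\<close> from the mean.\<close>
  have "p * (t - a) ^ 4 = (1 - p) ^ 4 * (p * t ^ 4)"
    by (simp add: a_def algebra_simps flip: power_mult_distrib)
  also have "\<dots> \<le> 1 * 2" using p t by (intro mult_mono power_le_one) auto
  finally have spike: "p * (t - a) ^ 4 \<le> 2" by simp
  have "a ^ 4 = (a\<^sup>2)\<^sup>2" by simp
  also have "\<dots> \<le> (1 / 16)\<^sup>2" using a by (intro power_mono) auto
  finally have "1 + 6 * a\<^sup>2 + a ^ 4 \<le> 2" using a by (simp add: power2_eq_square)
  then have "(1 - p) * (1 + 6 * a\<^sup>2 + a ^ 4) \<le> 1 * 2" using p by (intro mult_mono) auto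
  \<comment> \<open>Averaging over the points 1 and -1 cancels the odd powers of
    \<open>a\<close>.\<close>
  moreover have "((1 - a) ^ 4 + (- 1 - a) ^ 4) / 2 = 1 + 6 * a\<^sup>2 + a ^ 4" by algebra
  ultimately have bulk: "(1 - p) * ((1 - a) ^ 4 + (- 1 - a) ^ 4) / 2 \<le> 2"
    by (metis mult_1 times_divide_eq_right)
  have "(1 / 2)\<^sup>2 \<le> V\<^sup>2" using V by (intro power_mono) auto
  with spike bulk p show "(\<integral>x. (x - a) ^ 4 \<partial>spiked_law p t) \<le> 16 * V\<^sup>2"
    by (simp add: int power2_eq_square)
qed

section \<open>The two lower bounds\<close>

text \<open>The candidates have means 0 and \<open>\<eta>\<close> on the axis and variance 1 there,
  so the operator norm is 1 and half the distance of the means is the radius claimed.\<close>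

lemma gaussian_lower_bound:
  assumes n: "1 \<le> n" and \<eta>: "0 < \<eta>" "\<eta> < 1" and E: "E \<in> algorithms n m"
  shows "\<exists>D \<mu> S. distribution_on n D \<and> has_mean_cov n D \<mu> S \<and> gaussian n \<mu> S D \<and> 0 < op_norm n S \<and>
    (\<exists>A \<in> adversaries n m. 1 / 2 \<le> error_prob n m \<eta> D A E \<mu> (1 / 2 * (\<eta> * sqrt (op_norm n S))))"
proof -
  define h where "h x = max (normal_density 0 1 x) (normal_density \<eta> 1 x)" for x
  define a where "a b = (if b then 0 else \<eta>)" for b
  define N where "N b = density lborel (normal_density (a b) 1)" for b
  have h: "integrable lborel h" "(\<integral>x. h x \<partial>lborel) \<le> 1 + \<eta>"
    using normal_density_sup[of \<eta>] \<eta> by (simp_all add: h_def[abs_def])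
  \<comment> \<open>The right-hand side does not depend on \<open>b\<close>: the same
    \<open>h\<close> dominates both densities.\<close>
  have "\<exists>Q. prob_space Q \<and> sets Q = sets lborel \<and> (\<forall>X\<in>sets lborel.
      ennreal (1 - \<eta>) * emeasure (N b) X + ennreal \<eta> * emeasure Q X =
      emeasure (density lborel (\<lambda>x. ennreal (h x / (\<integral>x. h x \<partial>lborel)))) X)" for b
    by (rule complete_to_common_mixture[where f="normal_density (a b) 1" and h=h and M=lborel and \<eta>=\<eta>])
      (use h \<eta> in \<open>auto simp: N_def a_def h_def\<close>)
  then obtain Q where Q: "\<And>b. prob_space (Q b)" "\<And>b. sets (Q b) = sets borel"
    "\<And>b X. X \<in> sets borel \<Longrightarrow> ennreal (1 - \<eta>) * emeasure (N b) X + ennreal \<eta> * emeasure (Q b) X =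
      emeasure (density lborel (\<lambda>x. ennreal (h x / (\<integral>x. h x \<partial>lborel)))) X"
    unfolding sets_lborel by metis
  have N: "N b \<in> space (prob_algebra borel)" for b
    by (simp add: N_def space_prob_algebra prob_space_normal_density)
  have "\<exists>b. \<exists>A \<in> adversaries n m.
    1 / 2 \<le> error_prob n m \<eta> (distr (N b) (Rn n) (axis_embed n)) A E (axis_embed n (a b)) (1 / 2 * \<eta>)"
    using \<eta> by (intro indistinguishable_pair_lower_bound[OF n _ _ E N, where Q=Q])
      (auto simp: Q a_def space_prob_algebra)
  then obtain b A where A: "A \<in> adversaries n m"
    "1 / 2 \<le> error_prob n m \<eta> (distr (N b) (Rn n) (axis_embed n)) A E (axis_embed n (a b)) (1 / 2 * \<eta>)"
    by blast
  have "has_mean_cov n (distr (N b) (Rn n) (axis_embed n)) (axis_embed n (a b)) (first_diag 1)"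
    using N[of b] normal_moments[of "a b"]
    by (intro has_mean_cov_axis_embed) (auto simp: N_def space_prob_algebra)
  moreover have "gaussian n (axis_embed n (a b)) (first_diag 1) (distr (N b) (Rn n) (axis_embed n))"
    unfolding N_def by (rule gaussian_axis_embed[OF n])
  ultimately show ?thesis
    using A n by (intro exI[of _ "distr (N b) (Rn n) (axis_embed n)"] exI[of _ "axis_embed n (a b)"] exI[of _ "first_diag 1"])
      (auto simp: op_norm_first_diag distribution_on_axis_embed[OF N])
qed

text \<open>The two laws are mirror images of each other. Their means differ by
  \<open>2 * p / u\<close>, at least twice \<open>\<eta> powr (3/4)\<close>, while the variance
  stays bounded.\<close>

lemma fourth_moment_lower_bound:
  assumes n: "1 \<le> n" and \<eta>: "0 < \<eta>" "\<eta> < 1 / 16" and E: "E \<in> algorithms n m"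
  shows "\<exists>D \<mu> S. distribution_on n D \<and> has_mean_cov n D \<mu> S \<and> bounded_fourth_moments n 16 D \<mu> \<and>
    0 < op_norm n S \<and>
    (\<exists>A \<in> adversaries n m. 1 / 2 \<le> error_prob n m \<eta> D A E \<mu> (1 / 2 * (\<eta> powr (3/4) * sqrt (op_norm n S))))"
proof -
  \<comment> \<open>With \<open>p\<close> of order \<open>\<eta> = u ^ 4\<close>, an atom at
    \<open>1 / u\<close> is as far out as a bounded fourth moment \<open>p / u ^ 4\<close> permits;
    it moves the mean by about \<open>u ^ 3\<close>.\<close>
  define u where "u = \<eta> powr (1/4)"
  \<comment> \<open>After scaling by \<open>1 - \<eta>\<close>, the clean atom has mass exactly
    \<open>\<eta>\<close>, the mass of the noise atom at the opposite point.\<close>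
  define p where "p = \<eta> / (1 - \<eta>)"
  define t where "t b = (if b then 1 / u else - (1 / u))" for b
  define a where "a b = p * t b" for b
  define V where "V = p * (1 / u)\<^sup>2 + (1 - p) - (p * (1 / u))\<^sup>2"
  have u: "0 < u" "u ^ 4 = \<eta>" "\<eta> powr (3/4) = u ^ 3"
    using \<eta> by (simp_all add: u_def powr_powr flip: powr_realpow)
  \<comment> \<open>The bound \<open>1 / 16\<close> on \<open>\<eta>\<close> is used here to make
    \<open>p / u\<^sup>2 \<le> 2 * u\<^sup>2\<close> at most \<open>1 / 2\<close>, and below to get
    \<open>p \<le> 1 / 8\<close>.\<close>
  have "u ^ 4 < (1 / 2) ^ 4" using u \<eta> by (simp add: power4_eq_xxxx)
  then have u2: "u < 1 / 2" by (rule power_less_imp_less_base) simp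
  have p: "\<eta> \<le> p" "p \<le> 2 * \<eta>" "(1 - \<eta>) * p = \<eta>"
    using \<eta> by (auto simp: p_def field_simps)
  have "p * (1 / u)\<^sup>2 \<le> 2 * u ^ 4 * (1 / u)\<^sup>2" using p u by (intro mult_right_mono) auto
  also have "\<dots> = 2 * u\<^sup>2" using u(1) by (simp add: field_simps eval_nat_numeral)
  also have "\<dots> \<le> 2 * (1 / 2)\<^sup>2" using u u2 by (intro mult_left_mono power_mono) auto
  finally have t2: "p * (t b)\<^sup>2 \<le> 1 / 2" for b by (simp add: t_def power2_eq_square)
  have "p * (1 / u) ^ 4 \<le> 2 * u ^ 4 * (1 / u) ^ 4" using p u by (intro mult_right_mono) auto
  then have t4: "p * t b ^ 4 \<le> 2" for b using u(1) by (simp add: t_def field_simps)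
  have p8: "0 \<le> p" "p \<le> 1 / 8" using p \<eta> by auto
  \<comment> \<open>The variance is even in the position of the atom, so both laws have the same
    \<open>V\<close>.\<close>
  have V_eq: "p * (t b)\<^sup>2 + (1 - p) - (p * t b)\<^sup>2 = V" for b by (simp add: V_def t_def power2_eq_square)
  note mom = spiked_law_moments[OF p8 t2 t4, unfolded V_eq, folded a_def]
  define N where "N b = spiked_law p (t b)" for b
  define Q where "Q b = return (borel :: real measure) (- t b)" for b
  have N: "N b \<in> space (prob_algebra borel)" for b
    unfolding N_def by (rule spiked_law_in_prob_algebra)
  have Q: "Q b \<in> space (prob_algebra borel)" for b
    by (simp add: Q_def space_prob_algebra prob_space_return)
  \<comment> \<open>The common mixture is symmetric: each of \<open>1 / u\<close> and
    \<open>- (1 / u)\<close> carries mass \<open>\<eta>\<close>, one from the clean law and one from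
    the noise.\<close>
  have mix: "ennreal (1 - \<eta>) * emeasure (N b) X + ennreal \<eta> * emeasure (Q b) X =
      ennreal ((1 - \<eta>) * (1 - p) * (indicator X 1 + indicator X (- 1)) / 2 +
        \<eta> * (indicator X (1 / u) + indicator X (- (1 / u))))" if X: "X \<in> sets borel" for b X
  proof -
    have "emeasure (Q b) X = ennreal (indicator X (- t b))"
      using X by (simp add: Q_def ennreal_indicator)
    moreover have "emeasure (N b) X =
        ennreal (p * indicator X (t b) + (1 - p) * (indicator X 1 + indicator X (- 1)) / 2)"
      unfolding N_def using p8 X by (intro emeasure_spiked_law) auto
    ultimately have "ennreal (1 - \<eta>) * emeasure (N b) X + ennreal \<eta> * emeasure (Q b) X =
      ennreal ((1 - \<eta>) * (p * indicator X (t b) + (1 - p) * (indicator X 1 + indicator X (- 1)) / 2) +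
        \<eta> * indicator X (- t b))"
      using \<eta> p8 by (simp add: ennreal_mult'[symmetric] ennreal_plus[symmetric] del: ennreal_plus)
    also have "(1 - \<eta>) * (p * indicator X (t b) + (1 - p) * (indicator X 1 + indicator X (- 1)) / 2) +
        \<eta> * indicator X (- t b) = ((1 - \<eta>) * p) * indicator X (t b) + \<eta> * indicator X (- t b) +
        (1 - \<eta>) * (1 - p) * (indicator X 1 + indicator X (- 1)) / (2 :: real)"
      by (simp add: algebra_simps add_divide_distrib)
    also have "\<dots> = (1 - \<eta>) * (1 - p) * (indicator X 1 + indicator X (- 1)) / 2 +
        \<eta> * (indicator X (1 / u) + indicator X (- (1 / u)))"
      unfolding p(3) by (cases b) (simp_all add: t_def algebra_simps)
    finally show ?thesis .
  qed
  have "u ^ 3 = u ^ 4 * (1 / u)" using u(1) by (simp add: eval_nat_numeral)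
  also have "\<dots> \<le> p * (1 / u)" using p u by (intro mult_right_mono) auto
  finally have shift: "u ^ 3 \<le> p * (1 / u)" .
  \<comment> \<open>Weakening \<open>V \<le> 2\<close> to 4 keeps the root rational; the factor 2 is
    absorbed because the means lie on opposite sides of 0.\<close>
  have "sqrt V \<le> sqrt 4" using mom(4) by (intro real_sqrt_le_mono) simp
  then have "u ^ 3 * sqrt V \<le> u ^ 3 * 2" using u(1) by (intro mult_left_mono) auto
  with shift have "2 * (1 / 2 * (u ^ 3 * sqrt V)) \<le> 2 * (p * (1 / u))" by linarith
  also have "\<dots> = \<bar>a True - a False\<bar>" using p8 u(1) by (simp add: a_def t_def)
  finally have sep: "2 * (1 / 2 * (u ^ 3 * sqrt V)) \<le> \<bar>a True - a False\<bar>" .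
  have "\<exists>b. \<exists>A \<in> adversaries n m.
    1 / 2 \<le> error_prob n m \<eta> (distr (N b) (Rn n) (axis_embed n)) A E (axis_embed n (a b)) (1 / 2 * (u ^ 3 * sqrt V))"
    using \<eta> by (intro indistinguishable_pair_lower_bound[OF n _ _ E N, where Q=Q]) (use Q sep mix in auto)
  then obtain b A where A: "A \<in> adversaries n m"
    "1 / 2 \<le> error_prob n m \<eta> (distr (N b) (Rn n) (axis_embed n)) A E (axis_embed n (a b)) (1 / 2 * (u ^ 3 * sqrt V))"
    by blast
  have "has_mean_cov n (distr (N b) (Rn n) (axis_embed n)) (axis_embed n (a b)) (first_diag V)"
    using N[of b] mom(1,2)[of b]
    by (intro has_mean_cov_axis_embed) (auto simp: N_def space_prob_algebra integrable_spiked_law)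
  moreover have "bounded_fourth_moments n 16 (distr (N b) (Rn n) (axis_embed n)) (axis_embed n (a b))"
    using N[of b] mom(2,5)[of b]
    by (intro bounded_fourth_moments_axis_embed n) (auto simp: N_def space_prob_algebra integrable_spiked_law)
  ultimately show ?thesis
    using A n mom(3) u(3)
    by (intro exI[of _ "distr (N b) (Rn n) (axis_embed n)"] exI[of _ "axis_embed n (a b)"] exI[of _ "first_diag V"])
      (auto simp: op_norm_first_diag distribution_on_axis_embed[OF N])
qed

theorem mainTheorem3:
  "\<exists>\<eta>0 c p C4 :: real. 0 < \<eta>0 \<and> 0 < c \<and> 0 < p \<and> 0 < C4 \<and>
     (\<forall>(n::nat) (m::nat) (\<eta>::real). 1 \<le> n \<longrightarrow> 0 < \<eta> \<longrightarrow> \<eta> < \<eta>0 \<longrightarrow>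
       (\<forall>E \<in> algorithms n m.
         (\<exists>D \<mu> S. distribution_on n D \<and> has_mean_cov n D \<mu> S \<and> gaussian n \<mu> S D \<and> 0 < op_norm n S \<and>
            (\<exists>A \<in> adversaries n m.
               p \<le> error_prob n m \<eta> D A E \<mu> (c * (\<eta> * sqrt (op_norm n S))))) \<and>
         (\<exists>D \<mu> S. distribution_on n D \<and> has_mean_cov n D \<mu> S \<and> bounded_fourth_moments n C4 D \<mu> \<and>
            0 < op_norm n S \<and>
            (\<exists>A \<in> adversaries n m.
               p \<le> error_prob n m \<eta> D A E \<mu> (c * (\<eta> powr (3/4) * sqrt (op_norm n S)))))))"
  \<comment> \<open>The threshold \<open>1/16\<close> and the constant 16 come from the
    fourth-moment bound. The factor \<open>1/2\<close> of the radius and the probability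
    \<open>1/2\<close> serve both parts.\<close>
  by (rule exI[of _ "1/16"], rule exI[of _ "1/2"], rule exI[of _ "1/2"], rule exI[of _ 16])
    (use gaussian_lower_bound fourth_moment_lower_bound in auto)

end
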